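(* Let $\Sigma$ be a finite alphabet. If $L \subseteq \Sigma^{*}$ is regular, then $h(L) = 0$.
   Context: $\Sigma^{*}$ is the free monoid of words over $\Sigma$, and $\Sigma^{(n)}$ is the set of words of length at most $n$. For finite $F \subseteq \Sigma^{*}$ let $\Theta(F,L)$ be the equivalence relation on $\Sigma^{*}$ with $(u,v)\in\Theta(F,L)$ iff for all $w\in F$: $uw\in L \Leftrightarrow vw\in L$. Let $\gamma_L(F)$ be the (finite) number of its equivalence classes. The Myhill-Nerode entropy of $L$ is $h(L) := \limsup_{n\to\infty}\frac{1}{n}\log_2\gamma_L(\Sigma^{(n)})$. A language is regular if it is accepted by a deterministic finite automaton. *)

theory Defs
  imports Complex_Main "HOL-Library.Extended_Real"
begin

record ('s, 'a) dfa =
  states :: "'s set"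
  init :: 's
  accepting :: "'s set"
  step :: "'s \<Rightarrow> 'a \<Rightarrow> 's"

definition is_dfa :: "'a set \<Rightarrow> ('s, 'a) dfa \<Rightarrow> bool" where
  "is_dfa \<Sigma> M \<longleftrightarrow> finite (states M) \<and> init M \<in> states M \<and> accepting M \<subseteq> states M \<and>
     (\<forall>q\<in>states M. \<forall>a\<in>\<Sigma>. step M q a \<in> states M)"

definition dfa_language :: "'a set \<Rightarrow> ('s, 'a) dfa \<Rightarrow> 'a list set" where
  "dfa_language \<Sigma> M = {w \<in> lists \<Sigma>. foldl (step M) (init M) w \<in> accepting M}"

text \<open>States are taken in \<^typ>\<open>nat\<close> because HOL cannot quantify over the type of states. The
  lemma \<open>regular_dfa_language\<close> below shows that this loses no generality.\<close>

definition regular :: "'a set \<Rightarrow> 'a list set \<Rightarrow> bool" where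
  "regular \<Sigma> L \<longleftrightarrow> (\<exists>M :: (nat, 'a) dfa. is_dfa \<Sigma> M \<and> dfa_language \<Sigma> M = L)"

lemma regular_dfa_language:
  fixes M :: "('s, 'a) dfa"
  assumes M: "is_dfa \<Sigma> M"
  shows "regular \<Sigma> (dfa_language \<Sigma> M)"
proof -
  obtain f :: "'s \<Rightarrow> nat" where f: "inj_on f (states M)"
    using M finite_imp_inj_to_nat_seg unfolding is_dfa_def by metis
  define g where "g = the_inv_into (states M) f"
  have gf: "g (f q) = q" if "q \<in> states M" for q
    using that f by (simp add: g_def the_inv_into_f_f)
  define N where "N = \<lparr>states = f ` states M, init = f (init M), accepting = f ` accepting M,
    step = (\<lambda>q a. f (step M (g q) a))\<rparr>"
  have N: "is_dfa \<Sigma> N"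
    using M gf by (auto simp: is_dfa_def N_def)
  have run: "foldl (step M) q w \<in> states M \<and>
      foldl (step N) (f q) w = f (foldl (step M) q w)"
    if "w \<in> lists \<Sigma>" "q \<in> states M" for w q
    using that
  proof (induction w arbitrary: q)
    case Nil
    then show ?case by simp
  next
    case (Cons a w)
    then have "step M q a \<in> states M" using M by (auto simp: is_dfa_def)
    with Cons show ?case by (simp add: N_def gf)
  qed
  have "foldl (step N) (init N) w \<in> accepting N \<longleftrightarrow> foldl (step M) (init M) w \<in> accepting M"
    if w: "w \<in> lists \<Sigma>" for w
  proof -
    have i: "init M \<in> states M" and A: "accepting M \<subseteq> states M"
      using M by (auto simp: is_dfa_def)
    have "foldl (step N) (init N) w = f (foldl (step M) (init M) w)"
      using run[OF w i] by (simp add: N_def)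
    moreover have "accepting N = f ` accepting M" by (simp add: N_def)
    ultimately show ?thesis
      using inj_on_image_mem_iff[OF f _ A] run[OF w i] by simp
  qed
  then have "dfa_language \<Sigma> N = dfa_language \<Sigma> M"
    by (auto simp: dfa_language_def)
  with N show ?thesis unfolding regular_def by blast
qed

definition MN_rel :: "'a set \<Rightarrow> 'a list set \<Rightarrow> 'a list set \<Rightarrow> 'a list rel" where
  "MN_rel \<Sigma> F L = {(u, v). u \<in> lists \<Sigma> \<and> v \<in> lists \<Sigma> \<and> (\<forall>w\<in>F. u @ w \<in> L \<longleftrightarrow> v @ w \<in> L)}"

lemma equiv_MN_rel: "equiv (lists \<Sigma>) (MN_rel \<Sigma> F L)"
  by (rule equivI) (auto simp: MN_rel_def refl_on_def sym_def trans_def)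

lemma finite_classes_MN_rel:
  assumes "finite F"
  shows "finite (lists \<Sigma> // MN_rel \<Sigma> F L)"
proof -
  have "lists \<Sigma> // MN_rel \<Sigma> F L \<subseteq>
      (\<lambda>S. {v \<in> lists \<Sigma>. \<forall>w\<in>F. w \<in> S \<longleftrightarrow> v @ w \<in> L}) ` Pow F"
  proof
    fix X assume "X \<in> lists \<Sigma> // MN_rel \<Sigma> F L"
    then obtain u where u: "u \<in> lists \<Sigma>" "X = MN_rel \<Sigma> F L `` {u}" by (metis quotientE)
    have "X = {v \<in> lists \<Sigma>. \<forall>w\<in>F. w \<in> {w \<in> F. u @ w \<in> L} \<longleftrightarrow> v @ w \<in> L}"
      using u by (auto simp: MN_rel_def)
    then show "X \<in> (\<lambda>S. {v \<in> lists \<Sigma>. \<forall>w\<in>F. w \<in> S \<longleftrightarrow> v @ w \<in> L}) ` Pow F" by blast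
  qed
  then show ?thesis using assms by (meson finite_Pow_iff finite_imageI finite_subset)
qed

text \<open>By \<open>finite_classes_MN_rel\<close>, for finite \<open>F\<close> the cardinality below is the true number of classes.\<close>

definition MN_index :: "'a set \<Rightarrow> 'a list set \<Rightarrow> 'a list set \<Rightarrow> nat" where
  "MN_index \<Sigma> L F = card (lists \<Sigma> // MN_rel \<Sigma> F L)"

definition words_upto :: "'a set \<Rightarrow> nat \<Rightarrow> 'a list set" where
  "words_upto \<Sigma> n = {w \<in> lists \<Sigma>. length w \<le> n}"

text \<open>The entropy is an extended real, so the limit superior exists unconditionally; it is
  infinite for some languages.\<close>

definition MN_entropy :: "'a set \<Rightarrow> 'a list set \<Rightarrow> ereal" where
  "MN_entropy \<Sigma> L =
     limsup (\<lambda>n. ereal (1 / real n * log 2 (real (MN_index \<Sigma> L (words_upto \<Sigma> n)))))"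

end

theory Submission
  imports Defs
begin

text \<open>Fix a DFA for \<open>L\<close>. Whether \<open>u @ w\<close> lies in \<open>L\<close>
  depends on \<open>u\<close> only through the state reached after reading \<open>u\<close>, so for
  every set \<open>F\<close> of test words the number of classes is at most the number of states
  (\<open>MN_classes_dfa_subset\<close>, \<open>MN_index_dfa_bounds\<close>). Hence the logarithm of
  the index stays between 0 and a constant independent of \<open>n\<close>, and dividing by
  \<open>n\<close> sends it to 0.\<close>

lemma foldl_step_in_states:
  assumes "is_dfa \<Sigma> M" "q \<in> states M" "w \<in> lists \<Sigma>"
  shows "foldl (step M) q w \<in> states M"
  using assms(3,2,1) by (induction w arbitrary: q) (auto simp: is_dfa_def)

text \<open>Words leading to the same state are equivalent, so every class is determined by a state.\<close>

lemma MN_classes_dfa_subset: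
  assumes M: "is_dfa \<Sigma> M" and F: "F \<subseteq> lists \<Sigma>"
  defines "L \<equiv> dfa_language \<Sigma> M"
  shows "lists \<Sigma> // MN_rel \<Sigma> F L \<subseteq>
    (\<lambda>q. {v \<in> lists \<Sigma>. \<forall>w\<in>F. foldl (step M) q w \<in> accepting M \<longleftrightarrow> v @ w \<in> L}) ` states M"
proof
  fix X assume "X \<in> lists \<Sigma> // MN_rel \<Sigma> F L"
  then obtain u where u: "u \<in> lists \<Sigma>" "X = MN_rel \<Sigma> F L `` {u}"
    by (metis quotientE)
  let ?q = "foldl (step M) (init M) u"
  have "?q \<in> states M"
    using M u(1) by (intro foldl_step_in_states) (auto simp: is_dfa_def)
  \<comment> \<open>Since \<open>F\<close> consists of words over the alphabet, \<open>u @ w\<close>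
    does too, so membership in \<open>L\<close> is decided by the run alone, which splits at
    \<open>?q\<close>.\<close>
  moreover have "foldl (step M) ?q w \<in> accepting M \<longleftrightarrow> u @ w \<in> L" if "w \<in> F" for w
    using that u(1) F by (auto simp: L_def dfa_language_def)
  then have "X = {v \<in> lists \<Sigma>. \<forall>w\<in>F. foldl (step M) ?q w \<in> accepting M \<longleftrightarrow> v @ w \<in> L}"
    using u by (auto simp: MN_rel_def)
  ultimately show "X \<in> (\<lambda>q. {v \<in> lists \<Sigma>. \<forall>w\<in>F.
      foldl (step M) q w \<in> accepting M \<longleftrightarrow> v @ w \<in> L}) ` states M"
    by blast
qed

text \<open>The upper bound does not depend on \<open>F\<close>, so one constant serves all lengths
  \<open>n\<close>. The lower bound keeps the logarithm of the index nonnegative.\<close>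

lemma MN_index_dfa_bounds:
  assumes M: "is_dfa \<Sigma> M" and F: "F \<subseteq> lists \<Sigma>"
  shows "0 < MN_index \<Sigma> (dfa_language \<Sigma> M) F"
    and "MN_index \<Sigma> (dfa_language \<Sigma> M) F \<le> card (states M)"
proof -
  let ?Q = "lists \<Sigma> // MN_rel \<Sigma> F (dfa_language \<Sigma> M)"
  have fin: "finite (states M)"
    using M by (simp add: is_dfa_def)
  show "MN_index \<Sigma> (dfa_language \<Sigma> M) F \<le> card (states M)"
    unfolding MN_index_def by (rule surj_card_le[OF fin MN_classes_dfa_subset[OF M F]])
  \<comment> \<open>\<open>card\<close> of an infinite set is 0, so positivity requires finiteness
    as well as a class, such as that of the empty word.\<close>
  have "finite ?Q"
    using MN_classes_dfa_subset[OF M F] fin by (meson finite_imageI finite_subset)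
  moreover have "?Q \<noteq> {}"
    by (auto simp: quotient_def)
  ultimately show "0 < MN_index \<Sigma> (dfa_language \<Sigma> M) F"
    by (simp add: MN_index_def card_gt_0_iff)
qed

theorem corollary4p2:
  fixes \<Sigma> :: "'a set" and L :: "'a list set"
  assumes "finite \<Sigma>" and "L \<subseteq> lists \<Sigma>" and "regular \<Sigma> L"
  shows "MN_entropy \<Sigma> L = 0"
proof -
  obtain M :: "(nat, 'a) dfa" where M: "is_dfa \<Sigma> M" and L: "dfa_language \<Sigma> M = L"
    using assms(3) unfolding regular_def by blast
  define g where "g n = MN_index \<Sigma> L (words_upto \<Sigma> n)" for n
  define c where "c = log 2 (real (card (states M)))"
  have "words_upto \<Sigma> n \<subseteq> lists \<Sigma>" for n
    by (auto simp: words_upto_def)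
  then have pos: "0 < g n" and le: "g n \<le> card (states M)" for n
    using MN_index_dfa_bounds[OF M] unfolding L g_def by auto
  have log0: "0 \<le> log 2 (real (g n))" and logc: "log 2 (real (g n)) \<le> c" for n
    using pos[of n] le[of n] by (auto simp: c_def Suc_le_eq)
  \<comment> \<open>The squeeze is between 0 and \<open>c / n\<close>. Both bounds hold at every
    \<open>n\<close>, including \<open>n = 0\<close>, where \<open>1 / real n\<close> is 0 by
    convention.\<close>
  have "(\<lambda>n. 1 / real n * log 2 (real (g n))) \<longlonglongrightarrow> 0"
  proof (rule tendsto_sandwich[where f = "\<lambda>_. 0"])
    show "(\<lambda>n. 1 / real n * c) \<longlonglongrightarrow> 0"
      using tendsto_mult_left_zero[OF lim_1_over_n] .
    show "\<forall>\<^sub>F n in sequentially. 1 / real n * log 2 (real (g n)) \<le> 1 / real n * c"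
      using logc by (intro always_eventually allI mult_left_mono) auto
  qed (use log0 in auto)
  then have "(\<lambda>n. ereal (1 / real n * log 2 (real (g n)))) \<longlonglongrightarrow> 0"
    unfolding zero_ereal_def by (rule tendsto_ereal)
  then show ?thesis
    unfolding MN_entropy_def g_def by (rule lim_imp_Limsup[rotated]) simp
qed

end
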